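(* Let $H$ be a complex Hilbert space and let $A,B\in B(H)$ be such that $AB=BA$. If $A$ is normal, then $|A||B|=|B||A|$.
   Context: $B(H)$ denotes the algebra of bounded linear operators on $H$. For $T\in B(H)$, $|T|=\sqrt{T^*T}$ denotes the absolute value (modulus) of $T$, i.e. the unique positive square root of $T^*T$. An operator $T$ is normal if $TT^*=T^*T$. *)

theory Defs
  imports "HOL-Analysis.Analysis"
begin

class complex_vector = real_vector +
  fixes scaleC :: "complex \<Rightarrow> 'a \<Rightarrow> 'a"  (infixr "*\<^sub>C" 75)
  assumes scaleC_add_right: "a *\<^sub>C (x + y) = a *\<^sub>C x + a *\<^sub>C y"
    and scaleC_add_left: "(a + b) *\<^sub>C x = a *\<^sub>C x + b *\<^sub>C x"
    and scaleC_scaleC: "a *\<^sub>C b *\<^sub>C x = (a * b) *\<^sub>C x"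
    and scaleC_one: "1 *\<^sub>C x = x"
    and scaleR_scaleC: "r *\<^sub>R x = complex_of_real r *\<^sub>C x"

text \<open>The complex inner product is linear in its first argument. Its real part is the inner
  product of \<^class>\<open>real_inner\<close>, so positive definiteness and
  \<open>norm x = sqrt (Re (cinner x x))\<close> are inherited from there
  (\<open>cinner x x\<close> is real by conjugate symmetry).\<close>

class complex_inner = complex_vector + real_inner +
  fixes cinner :: "'a \<Rightarrow> 'a \<Rightarrow> complex"
  assumes cinner_commute: "cinner x y = cnj (cinner y x)"
    and cinner_add_left: "cinner (x + y) z = cinner x z + cinner y z"
    and cinner_scaleC_left: "cinner (a *\<^sub>C x) y = a * cinner x y"
    and Re_cinner: "Re (cinner x y) = inner x y"

class complex_hilbert_space = complex_inner + complete_space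

instantiation complex :: complex_hilbert_space
begin

definition scaleC_complex :: "complex \<Rightarrow> complex \<Rightarrow> complex" where
  "scaleC_complex a x = a * x"

definition cinner_complex :: "complex \<Rightarrow> complex \<Rightarrow> complex" where
  "cinner_complex x y = x * cnj y"

instance
  by standard
    (auto simp: scaleC_complex_def cinner_complex_def inner_complex_def scaleR_conv_of_real
      algebra_simps)

end

definition bounded_clinear :: "('a::complex_inner \<Rightarrow> 'a) \<Rightarrow> bool" where
  "bounded_clinear T \<longleftrightarrow> bounded_linear T \<and> (\<forall>c x. T (c *\<^sub>C x) = c *\<^sub>C T x)"

text \<open>By the Riesz representation theorem the described operator exists (and is bounded) for every
  bounded operator on a Hilbert space.\<close>

definition cadjoint :: "('a::complex_hilbert_space \<Rightarrow> 'a) \<Rightarrow> 'a \<Rightarrow> 'a" where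
  "cadjoint T = (THE S. \<forall>x y. cinner (T x) y = cinner x (S y))"

definition normal_operator :: "('a::complex_hilbert_space \<Rightarrow> 'a) \<Rightarrow> bool" where
  "normal_operator T \<longleftrightarrow> T \<circ> cadjoint T = cadjoint T \<circ> T"

definition positive_operator :: "('a::complex_inner \<Rightarrow> 'a) \<Rightarrow> bool" where
  "positive_operator P \<longleftrightarrow>
     bounded_clinear P \<and> (\<forall>x. cinner (P x) x \<in> \<real> \<and> 0 \<le> Re (cinner (P x) x))"

definition modulus :: "('a::complex_hilbert_space \<Rightarrow> 'a) \<Rightarrow> 'a \<Rightarrow> 'a" where
  "modulus T = (THE P. positive_operator P \<and> P \<circ> P = cadjoint T \<circ> T)"

end

theory Submission
  imports Defs "HOL-Complex_Analysis.Cauchy_Integral_Formula"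
begin

text \<open>
  The moduli commute as soon as their squares do, because the positive square root of a positive
  operator \<open>G\<close> commutes with every bounded operator that commutes with \<open>G\<close>
  (\<open>modulus_commute\<close>): from \<open>B\<^sup>*B\<close> commuting with \<open>A\<^sup>*A\<close> one gets \<open>B\<^sup>*B\<close> commuting with
  \<open>|A|\<close>, and from that \<open>|A|\<close> commuting with \<open>|B|\<close>. For the squares, Fuglede's theorem gives
  \<open>A\<^sup>*B = BA\<^sup>*\<close>; passing to adjoints, each of \<open>A, A\<^sup>*\<close> commutes with each of \<open>B, B\<^sup>*\<close>.

  Fuglede's theorem (\<open>fuglede\<close>) is proved by Rosenblum's argument. Since \<open>A\<close> commutes with \<open>B\<close> and
  with \<open>A\<^sup>*\<close>, the \<open>n\<close>-fold commutator of \<open>K = zA\<^sup>* - cnj(z)A\<close> with \<open>B\<close> is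
  \<open>z\<^sup>n\<close> times that of \<open>A\<^sup>*\<close> with \<open>B\<close>. Hence \<open>exp(K) B exp(-K)\<close> is an entire power
  series in \<open>z\<close> with coefficient \<open>A\<^sup>*B - BA\<^sup>*\<close> at \<open>z\<close>. It is bounded, as \<open>K\<close> is skew-adjoint and so
  \<open>exp(K)\<close> is isometric; by Liouville's theorem the coefficient vanishes. The conjugation by \<open>exp(K)\<close>
  is never formed as a product: it is treated as the value at time \<open>1\<close> of the linear differential
  equation \<open>X' = KX - XK\<close>, whose solution is the exponential series of the commutator
  (\<open>exponential_flow\<close>, \<open>commutator_exponential_contraction\<close>).

  The square root of \<open>T\<^sup>*T\<close>, rescaled so that \<open>S = 1 - T\<^sup>*T\<close> is a contraction, is \<open>1 - Y\<close> where \<open>Y\<close>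
  is the limit of the iteration \<open>Y \<mapsto> (S + Y\<^sup>2)/2\<close> started at \<open>0\<close> (\<open>square_root_iteration\<close>). All
  iterates are polynomials in \<open>S\<close>, which yields symmetry and the commutation property of the root at
  once; the latter in turn makes the root unique.
\<close>

section \<open>Complex inner products\<close>

instance complex_hilbert_space \<subseteq> banach ..

lemma cinner_add_right: "cinner x (y + z) = cinner x y + cinner x z"
  for x :: "'a::complex_inner"
  by (metis cinner_add_left cinner_commute complex_cnj_add)

lemma cinner_scaleC_right: "cinner x (a *\<^sub>C y) = cnj a * cinner x y"
  for x :: "'a::complex_inner"
  by (metis cinner_scaleC_left cinner_commute complex_cnj_mult)

lemma cinner_diff_left: "cinner (x - y) z = cinner x z - cinner y z"
  for x :: "'a::complex_inner"
  by (metis add_diff_cancel_right' cinner_add_left diff_add_cancel)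

lemma cinner_diff_right: "cinner x (y - z) = cinner x y - cinner x z"
  for x :: "'a::complex_inner"
  by (metis add_diff_cancel_right' cinner_add_right diff_add_cancel)

text \<open>This reduces identities for \<open>cinner\<close> to identities for the real inner product, at the price of
  multiplying a vector by \<open>\<i>\<close>.\<close>

lemma cinner_eq_Complex: "cinner x y = Complex (inner x y) (- inner (\<i> *\<^sub>C x) y)"
  for x :: "'a::complex_inner"
  by (simp add: complex_eq_iff Re_cinner flip: Re_cinner) (simp add: cinner_scaleC_left)

lemma cinner_right_ext:
  fixes u v :: "'a::complex_inner"
  assumes "\<And>x. cinner x u = cinner x v"
  shows "u = v"
proof -
  have "inner x u = inner x v" for x using assms[of x] by (metis Re_cinner)
  then show ?thesis by (metis vector_eq_ldot)
qed

lemma cinner_left_ext: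
  fixes u v :: "'a::complex_inner"
  assumes "\<And>y. cinner u y = cinner v y"
  shows "u = v"
  by (rule cinner_right_ext) (metis assms cinner_commute)

lemma norm_scaleC: "norm (a *\<^sub>C x) = cmod a * norm x"
  for x :: "'a::complex_inner"
proof -
  have im: "Im (cinner x x) = 0" using cinner_commute[of x x] by (simp add: complex_eq_iff)
  have "inner (a *\<^sub>C x) (a *\<^sub>C x) = Re (a * cnj a * cinner x x)"
    by (simp add: cinner_scaleC_left cinner_scaleC_right im algebra_simps flip: Re_cinner)
  also have "a * cnj a = complex_of_real ((cmod a)\<^sup>2)"
    using complex_norm_square[of a] by simp
  finally have "(norm (a *\<^sub>C x))\<^sup>2 = (cmod a * norm x)\<^sup>2"
    unfolding power_mult_distrib power2_norm_eq_inner[where 'a='a]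
    by (simp only: times_complex.sel Re_complex_of_real Im_complex_of_real Re_cinner)
  then show ?thesis by (simp add: power2_eq_iff_nonneg)
qed

lemma scaleC_diff_right: "a *\<^sub>C (x - y) = a *\<^sub>C x - a *\<^sub>C y"
  for x :: "'a::complex_vector"
  by (metis add_diff_cancel_right' scaleC_add_right diff_add_cancel)

lemma bounded_linear_scaleC: "bounded_linear (\<lambda>x::'a::complex_inner. a *\<^sub>C x)"
proof (rule bounded_linear_intro[of _ "cmod a"])
  fix r :: real and x :: 'a
  show "a *\<^sub>C r *\<^sub>R x = r *\<^sub>R a *\<^sub>C x" by (simp add: scaleR_scaleC scaleC_scaleC mult.commute)
qed (auto simp: scaleC_add_right norm_scaleC mult.commute)

text \<open>The phase of \<open>cinner x y\<close> can be rotated into \<open>x\<close>, after which the real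
  Cauchy-Schwarz inequality applies.\<close>

lemma norm_cinner_le: "cmod (cinner x y) \<le> norm x * norm y"
  for x :: "'a::complex_inner"
proof -
  define w where "w = cnj (sgn (cinner x y))"
  have w: "cmod w \<le> 1" by (simp add: w_def norm_sgn)
  have "w * cinner x y = complex_of_real (cmod (cinner x y))"
    by (simp add: w_def sgn_eq complex_norm_square[symmetric] power2_eq_square mult.commute)
  then have "cmod (cinner x y) = Re (cinner (w *\<^sub>C x) y)"
    by (simp add: cinner_scaleC_left)
  also have "\<dots> \<le> norm (w *\<^sub>C x) * norm y"
    unfolding Re_cinner by (rule norm_cauchy_schwarz)
  also have "\<dots> \<le> norm x * norm y"
    using w by (auto simp: norm_scaleC intro!: mult_right_mono mult_left_le_one_le)
  finally show ?thesis .
qed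

lemma bounded_linear_cinner_left: "bounded_linear (\<lambda>x::'a::complex_inner. cinner x y)"
proof (rule bounded_linear_intro[of _ "norm y"])
  fix r :: real and x :: 'a
  show "cinner (r *\<^sub>R x) y = r *\<^sub>R cinner x y"
    by (simp only: scaleR_scaleC[of r x] cinner_scaleC_left scaleR_conv_of_real)
qed (auto simp: cinner_add_left norm_cinner_le)

section \<open>Adjoints\<close>

text \<open>The representing vector is the minimiser of \<open>J x = \<parallel>x\<parallel>\<^sup>2/2 - f x\<close>: the parallelogram law makes
  minimising sequences Cauchy, and the first variation of \<open>J\<close> at its minimum is
  \<open>h \<mapsto> inner h y - f h\<close>.\<close>

lemma riesz_representation:
  fixes f :: "'a::{real_inner,banach} \<Rightarrow> real"
  assumes f: "bounded_linear f"
  shows "\<exists>y. \<forall>x. f x = inner x y"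
proof -
  interpret f: bounded_linear f by fact
  obtain M where M: "\<And>x. \<bar>f x\<bar> \<le> norm x * M" using f.bounded by auto
  define J where "J x = inner x x / 2 - f x" for x
  have lower: "- M\<^sup>2 / 2 \<le> J x" for x
  proof -
    have "0 \<le> (norm x - M)\<^sup>2" by simp
    then show ?thesis using M[of x] by (simp add: J_def dot_square_norm power2_diff)
  qed
  then have bdd: "bdd_below (range J)" by (intro bdd_belowI2)
  define m where "m = Inf (range J)"
  have m_le: "m \<le> J x" for x unfolding m_def by (rule cInf_lower) (use bdd in auto)
  have "\<exists>x. J x < m + 1 / Suc n" for n
    using cInf_lessD[of "range J" "m + 1 / Suc n"] by (auto simp: m_def)
  then obtain X where X: "\<And>n. J (X n) < m + 1 / Suc n" by metis
  have par: "(dist x y)\<^sup>2 / 4 = J x + J y - 2 * J ((1/2) *\<^sub>R (x + y))" for x y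
    by (simp add: J_def dist_norm power2_norm_eq_inner f.add f.scaleR inner_add inner_diff
        inner_commute field_simps)
  have "Cauchy X"
  proof (rule metric_CauchyI)
    fix e :: real assume e: "e > 0"
    obtain N where N: "1 / Suc N < e\<^sup>2 / 8"
      using reals_Archimedean[of "e\<^sup>2 / 8"] e by (auto simp: inverse_eq_divide)
    have "dist (X k) (X l) < e" if "k \<ge> N" "l \<ge> N" for k l
    proof -
      have "1 / real (Suc k) \<le> 1 / Suc N" "1 / real (Suc l) \<le> 1 / Suc N"
        using that by (auto simp: field_simps)
      then have "(dist (X k) (X l))\<^sup>2 < e\<^sup>2"
        using par[of "X k" "X l"] X[of k] X[of l] m_le[of "(1/2) *\<^sub>R (X k + X l)"] N by linarith
      then show ?thesis using e by (simp add: power2_less_imp_less)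
    qed
    then show "\<exists>N. \<forall>k\<ge>N. \<forall>l\<ge>N. dist (X k) (X l) < e" by blast
  qed
  then obtain y where y: "X \<longlonglongrightarrow> y" using Cauchy_convergent convergent_def by blast
  have "(\<lambda>n. J (X n)) \<longlonglongrightarrow> J y"
    unfolding J_def by (intro tendsto_intros f.tendsto y) simp
  moreover have "(\<lambda>n. m + 1 / real (Suc n)) \<longlonglongrightarrow> m + 0"
    by (intro tendsto_intros LIMSEQ_Suc lim_1_over_n)
  ultimately have Jy: "J y \<le> m"
    using X by (auto intro: LIMSEQ_le less_imp_le)
  have "f h = inner h y" for h
  proof (rule ccontr)
    assume ne: "f h \<noteq> inner h y"
    \<comment> \<open>moving from \<open>y\<close> by \<open>t\<close> times \<open>h\<close> with this \<open>t\<close> would push \<open>J\<close> below its minimum; the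
      summand \<open>1\<close> only keeps the denominator nonzero\<close>
    define c where "c = f h - inner h y"
    define t where "t = c / (inner h h + 1)"
    have h: "inner h h + 1 > 0" by (simp add: add_nonneg_pos)
    have "J (y + t *\<^sub>R h) = J y - t * c + t\<^sup>2 * inner h h / 2"
      by (simp add: J_def c_def f.add f.scaleR inner_add inner_commute power2_eq_square
          field_simps)
    then have "t * c \<le> t\<^sup>2 * inner h h / 2" using Jy m_le[of "y + t *\<^sub>R h"] by linarith
    moreover have "t * c = t\<^sup>2 * (inner h h + 1)"
      using h by (simp add: t_def power2_eq_square)
    moreover have "t\<^sup>2 * inner h h \<ge> 0" "t\<^sup>2 > 0"
      using ne h by (auto simp: t_def c_def)
    ultimately show False unfolding distrib_left by linarith
  qed
  then show ?thesis by blast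
qed

lemma bounded_clinear_imp_bounded_linear: "bounded_clinear T \<Longrightarrow> bounded_linear T"
  by (simp add: bounded_clinear_def)

lemma bounded_clinear_scaleC: "bounded_clinear T \<Longrightarrow> T (c *\<^sub>C x) = c *\<^sub>C T x"
  by (simp add: bounded_clinear_def)

lemma bounded_clinear_diff: "bounded_clinear T \<Longrightarrow> T (x - y) = T x - T y"
  by (simp add: bounded_clinear_def bounded_linear.linear linear_diff)

lemma bounded_clinear_add: "bounded_clinear T \<Longrightarrow> T (x + y) = T x + T y"
  by (simp add: bounded_clinear_def bounded_linear.linear linear_add)

lemma bounded_clinear_commutator:
  assumes "bounded_clinear S" "bounded_clinear T"
  shows "bounded_clinear (\<lambda>x. S (T x) - T (S x))"
  using assms unfolding bounded_clinear_def
  by (auto intro!: bounded_linear_sub bounded_linear_compose[of S T] bounded_linear_compose[of T S]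
      simp: scaleC_diff_right)

text \<open>The adjoint is constructed from real Riesz representation; it intertwines the complex inner
  products because an operator commuting with multiplication by \<open>\<i>\<close> transports the imaginary part
  of \<open>cinner\<close> along with the real part.\<close>

lemma cinner_cadjoint:
  fixes T :: "'a::complex_hilbert_space \<Rightarrow> 'a"
  assumes T: "bounded_clinear T"
  shows "cinner (T x) y = cinner x (cadjoint T y)"
proof -
  have "\<exists>z. \<forall>x. inner (T x) y = inner x z" for y
    by (intro riesz_representation bounded_linear_compose[OF bounded_linear_inner_left]
        bounded_clinear_imp_bounded_linear T)
  then obtain S where S: "\<And>x y. inner (T x) y = inner x (S y)" by metis
  have "cinner (T x) y = cinner x (S y)" for x y
    unfolding cinner_eq_Complex S[symmetric] bounded_clinear_scaleC[OF T] ..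
  then have "\<exists>!S. \<forall>x y. cinner (T x) y = cinner x (S y)"
    by (intro ex1I[of _ S]) (auto intro!: ext[OF cinner_right_ext])
  from theI'[OF this] show ?thesis unfolding cadjoint_def by blast
qed

lemma cinner_cadjoint_left:
  fixes T :: "'a::complex_hilbert_space \<Rightarrow> 'a"
  assumes "bounded_clinear T"
  shows "cinner (cadjoint T x) y = cinner x (T y)"
  by (metis assms cinner_cadjoint cinner_commute)

lemma norm_cadjoint_le:
  fixes T :: "'a::complex_hilbert_space \<Rightarrow> 'a"
  assumes T: "bounded_clinear T" and c: "\<And>x. norm (T x) \<le> c * norm x"
  shows "norm (cadjoint T y) \<le> c * norm y"
proof -
  let ?w = "cadjoint T y"
  have "norm ?w * norm ?w = inner (T ?w) y"
    by (simp add: cinner_cadjoint[OF T] flip: Re_cinner)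
       (simp add: Re_cinner dot_square_norm power2_eq_square)
  also have "\<dots> \<le> norm (T ?w) * norm y" by (rule norm_cauchy_schwarz)
  also have "\<dots> \<le> c * norm ?w * norm y" using c by (intro mult_right_mono) auto
  finally have "norm ?w * norm ?w \<le> norm ?w * (c * norm y)" by (simp add: mult_ac)
  moreover have "0 \<le> c * norm y" using c[of y] norm_ge_zero order_trans by blast
  ultimately show ?thesis by (cases "norm ?w = 0") auto
qed

lemma bounded_clinear_cadjoint:
  fixes T :: "'a::complex_hilbert_space \<Rightarrow> 'a"
  assumes T: "bounded_clinear T"
  shows "bounded_clinear (cadjoint T)"
proof -
  obtain c where c: "\<And>x. norm (T x) \<le> norm x * c"
    using bounded_linear.bounded[OF bounded_clinear_imp_bounded_linear[OF T]] by blast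
  have sc: "cadjoint T (a *\<^sub>C x) = a *\<^sub>C cadjoint T x" for a x
    by (rule cinner_right_ext) (simp add: cinner_cadjoint[OF T, symmetric] cinner_scaleC_right)
  moreover have "bounded_linear (cadjoint T)"
  proof (rule bounded_linear_intro[of _ c])
    show "cadjoint T (x + y) = cadjoint T x + cadjoint T y" for x y
      by (rule cinner_right_ext) (simp add: cinner_cadjoint[OF T, symmetric] cinner_add_right)
    show "norm (cadjoint T x) \<le> norm x * c" for x
      using norm_cadjoint_le[OF T, of c x] c by (simp add: mult.commute)
  qed (simp add: scaleR_scaleC sc)
  ultimately show ?thesis by (simp add: bounded_clinear_def)
qed

section \<open>Exponential flows\<close>

text \<open>The curve \<open>u\<close> is \<open>t \<mapsto> exp(tL) x\<close>. The series is needed alongside the differential equation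
  because the dependence on a complex parameter will be read off from it. On bounded time intervals
  it converges uniformly, and its termwise derivative is \<open>L\<close> applied to the series shifted by one.\<close>

lemma exponential_flow:
  fixes L :: "'a::banach \<Rightarrow>\<^sub>L 'a"
  obtains u where "u 0 = x"
    and "\<And>t. (\<lambda>n. (t ^ n / fact n) *\<^sub>R ((blinfun_apply L ^^ n) x)) sums u t"
    and "\<And>t. (u has_vector_derivative L (u t)) (at t)"
proof -
  define a where "a n = (blinfun_apply L ^^ n) x" for n
  define u where "u t = (\<Sum>n. (t ^ n / fact n) *\<^sub>R a n)" for t :: real
  have na: "norm (a n) \<le> norm L ^ n * norm x" for n
  proof (induction n)
    case (Suc n)
    have "norm (a (Suc n)) \<le> norm L * norm (a n)" by (simp add: a_def norm_blinfun)
    also have "\<dots> \<le> norm L * (norm L ^ n * norm x)" by (intro mult_left_mono Suc) auto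
    finally show ?case by (simp add: mult_ac)
  qed (simp add: a_def)
  have exps: "summable (\<lambda>n. c ^ n / fact n)" for c :: real
    using summable_exp[of c] by (simp add: divide_inverse mult.commute)
  have bound: "norm ((t ^ n / fact n) *\<^sub>R a n) \<le> (R * norm L) ^ n / fact n * norm x"
    if "\<bar>t\<bar> \<le> R" for t R n
  proof -
    have "\<bar>t\<bar> ^ n * norm (a n) \<le> R ^ n * (norm L ^ n * norm x)"
      using that by (intro mult_mono power_mono na) auto
    then show ?thesis
      by (simp add: power_abs power_mult_distrib divide_right_mono mult_ac)
  qed
  have summ: "summable (\<lambda>n. (t ^ n / fact n) *\<^sub>R a n)" for t
    by (rule summable_comparison_test'[OF summable_mult2[OF exps] bound[of t "\<bar>t\<bar>"]]) auto
  then have sums: "(\<lambda>n. (t ^ n / fact n) *\<^sub>R a n) sums u t" for t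
    unfolding u_def by (rule summable_sums)
  have der: "(u has_vector_derivative L (u t)) (at t)" for t
  proof -
    define S where "S = ball (0::real) (\<bar>t\<bar> + 1)"
    \<comment> \<open>termwise derivatives; the constant term drops out, so partial sums shift by one\<close>
    define d where "d n s = (if n = 0 then 0 else (s ^ (n - 1) / fact (n - 1)) *\<^sub>R a n)"
      for n and s :: real
    have deriv: "((\<lambda>s. (s ^ n / fact n) *\<^sub>R a n) has_derivative (\<lambda>h. h *\<^sub>R d n s)) (at s within S)"
      for n s
    proof (cases n)
      case (Suc k)
      have "((\<lambda>s::real. s ^ n / fact n) has_real_derivative s ^ k / fact k) (at s within S)"
        using DERIV_cdivide[OF DERIV_pow[of n s S], of "fact n"]
        by (simp add: Suc del: of_nat_Suc power_Suc)
      from has_vector_derivative_scaleR[OF this has_vector_derivative_const]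
      show ?thesis by (simp add: has_vector_derivative_def d_def Suc)
    qed (simp add: d_def)
    have lim: "uniform_limit S (\<lambda>n s. \<Sum>i<n. (s ^ i / fact i) *\<^sub>R a i)
        (\<lambda>s. \<Sum>i. (s ^ i / fact i) *\<^sub>R a i) sequentially"
      by (rule Weierstrass_m_test[OF bound[of _ "\<bar>t\<bar> + 1"] summable_mult2[OF exps]])
         (auto simp: S_def)
    have shift: "(\<Sum>i<Suc n. d i s) = L (\<Sum>i<n. (s ^ i / fact i) *\<^sub>R a i)" for n s
      by (simp only: sum.lessThan_Suc_shift)
         (simp add: d_def a_def blinfun.sum_right blinfun.scaleR_right)
    have conv: "\<forall>\<^sub>F n in sequentially. \<forall>s\<in>S. \<forall>h.
        norm (sum (\<lambda>i. h *\<^sub>R d i s) {..<n} - h *\<^sub>R L (u s)) \<le> e * norm h" if e: "e > 0" for e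
    proof -
      define e' where "e' = e / (norm L + 1)"
      have L1: "norm L + 1 > 0" by (simp add: add_nonneg_pos)
      have "e' > 0" using e L1 by (simp add: e'_def)
      from uniform_limitD[OF lim this]
      have "\<forall>\<^sub>F n in sequentially. \<forall>s\<in>S. dist (\<Sum>i<n. (s ^ i / fact i) *\<^sub>R a i) (u s) < e'"
        by (simp add: u_def)
      then have "\<forall>\<^sub>F n in sequentially. \<forall>s\<in>S. \<forall>h.
        norm (sum (\<lambda>i. h *\<^sub>R d i s) {..<Suc n} - h *\<^sub>R L (u s)) \<le> e * norm h"
      proof (eventually_elim, intro ballI allI)
        fix n s h
        assume *: "\<forall>s\<in>S. dist (\<Sum>i<n. (s ^ i / fact i) *\<^sub>R a i) (u s) < e'" and s: "s \<in> S"
        let ?p = "\<Sum>i<n. (s ^ i / fact i) *\<^sub>R a i"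
        have "sum (\<lambda>i. h *\<^sub>R d i s) {..<Suc n} - h *\<^sub>R L (u s) = h *\<^sub>R L (?p - u s)"
          unfolding scaleR_sum_right[symmetric] shift
          by (simp add: blinfun.diff_right scaleR_diff_right)
        also have "norm \<dots> \<le> \<bar>h\<bar> * (norm L * norm (?p - u s))"
          by (simp add: norm_blinfun mult_left_mono)
        also have "\<dots> \<le> \<bar>h\<bar> * (norm L * e')"
          using * s by (intro mult_left_mono) (auto simp: dist_norm intro: less_imp_le)
        also have "\<dots> \<le> \<bar>h\<bar> * e"
          using L1 e by (intro mult_left_mono) (auto simp: e'_def field_simps)
        finally show "norm (sum (\<lambda>i. h *\<^sub>R d i s) {..<Suc n} - h *\<^sub>R L (u s)) \<le> e * norm h"
          by (simp add: mult.commute)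
      qed
      then show ?thesis by (subst eventually_sequentially_Suc[symmetric])
    qed
    have tS: "t \<in> S" "open S" "convex S" by (auto simp: S_def)
    obtain g where g: "\<And>s. s \<in> S \<Longrightarrow> (\<lambda>n. (s ^ n / fact n) *\<^sub>R a n) sums g s"
      "\<And>s. s \<in> S \<Longrightarrow> (g has_derivative (\<lambda>h. h *\<^sub>R L (u s))) (at s within S)"
      using has_derivative_series[OF tS(3) deriv conv tS(1) sums[of t]] by blast
    have gu: "g s = u s" if "s \<in> S" for s using sums_unique2[OF g(1)[OF that] sums] .
    have "(g has_vector_derivative L (u t)) (at t)"
      using g(2)[OF tS(1)] unfolding has_vector_derivative_def at_within_open[OF tS(1,2)] .
    then show ?thesis
      by (rule has_vector_derivative_transform_within_open[OF _ tS(2,1)]) (rule gu)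
  qed
  have "(\<lambda>n. (0 ^ n / fact n :: real) *\<^sub>R a n) = (\<lambda>n. if n = 0 then x else 0)"
    by (auto simp: a_def)
  then have "u 0 = x" using sums_unique2[OF sums[of 0]] sums_single[of 0 "\<lambda>_. x"] by simp
  then show ?thesis using sums der by (intro that[of u]) (auto simp: a_def)
qed

section \<open>Fuglede's theorem\<close>

text \<open>For skew \<open>K\<close> the derivative \<open>2 inner (K u) u\<close> of \<open>inner u u\<close> along the flow is zero.\<close>

lemma norm_skew_flow:
  fixes K :: "'a::{real_inner,banach} \<Rightarrow>\<^sub>L 'a"
  assumes skew: "\<And>x y. inner (K x) y = - inner x (K y)"
    and u: "\<And>t. (u has_vector_derivative K (u t)) (at t)"
  shows "norm (u s) = norm (u t)"
proof -
  have "((\<lambda>t. inner (u t) (u t)) has_vector_derivative 0) (at t)" for t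
    using bounded_bilinear.has_vector_derivative[OF bounded_bilinear_inner u u, of t]
      skew[of "u t" "u t"]
    by (simp add: inner_commute)
  then obtain c where "\<And>t. inner (u t) (u t) = c"
    using has_vector_derivative_zero_constant[of UNIV "\<lambda>t. inner (u t) (u t)"] by auto
  then show ?thesis by (simp add: norm_eq_sqrt_inner)
qed

text \<open>Here \<open>Y\<close> is \<open>exp(K) X exp(-K)\<close>. Along \<open>X' = KX - XK\<close>, with \<open>p\<close> and \<open>q\<close> solving \<open>p' = Kp\<close> and
  \<open>q' = Kq\<close>, the quantity \<open>inner (X p) q\<close> is constant; comparing times \<open>0\<close> and \<open>1\<close> and using that
  \<open>p\<close> and \<open>q\<close> have constant norm bounds the operator at time \<open>1\<close> by the one at time \<open>0\<close>.\<close>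

lemma commutator_exponential_contraction:
  fixes K X :: "'a::{real_inner,banach} \<Rightarrow>\<^sub>L 'a"
  assumes skew: "\<And>x y. inner (K x) y = - inner x (K y)"
  obtains Y where "norm Y \<le> norm X"
    and "(\<lambda>n. (1 / fact n) *\<^sub>R (((\<lambda>Z. (K o\<^sub>L Z) - (Z o\<^sub>L K)) ^^ n) X)) sums Y"
proof -
  define ad where "ad = Blinfun (\<lambda>Z. (K o\<^sub>L Z) - (Z o\<^sub>L K))"
  have ad: "blinfun_apply ad = (\<lambda>Z. (K o\<^sub>L Z) - (Z o\<^sub>L K))"
    unfolding ad_def
    by (intro bounded_linear_Blinfun_apply bounded_linear_intros)
  obtain \<phi> where \<phi>: "\<phi> 0 = X"
    "\<And>t. (\<lambda>n. (t ^ n / fact n) *\<^sub>R ((blinfun_apply ad ^^ n) X)) sums \<phi> t"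
    "\<And>t. (\<phi> has_vector_derivative ad (\<phi> t)) (at t)"
    using exponential_flow[of X ad] by blast
  have "norm (\<phi> 1 x) \<le> norm X * norm x" for x
  proof -
    define y where "y = \<phi> 1 x"
    \<comment> \<open>trajectories with prescribed value at time \<open>1\<close>: this replaces inverting \<open>exp(K)\<close>\<close>
    have flow_at_1: "\<exists>p. p 1 = z \<and> (\<forall>t. (p has_vector_derivative K (p t)) (at t))" for z
    proof -
      obtain u where u: "u 0 = z" "\<And>t. (u has_vector_derivative K (u t)) (at t)"
        using exponential_flow[of z K] by blast
      have "((\<lambda>t. u (t - 1)) has_vector_derivative K (u (t - 1))) (at t)" for t
      proof -
        have "((\<lambda>t. t - 1) has_vector_derivative 1) (at t)"
          by (auto intro!: derivative_eq_intros)
        from vector_diff_chain_at[OF this u(2)] show ?thesis by (simp add: o_def)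
      qed
      with u(1) show ?thesis by (intro exI[of _ "\<lambda>t. u (t - 1)"]) auto
    qed
    obtain p where p: "p 1 = x" "\<And>t. (p has_vector_derivative K (p t)) (at t)"
      using flow_at_1 by metis
    obtain q where q: "q 1 = y" "\<And>t. (q has_vector_derivative K (q t)) (at t)"
      using flow_at_1 by metis
    have "((\<lambda>t. \<phi> t (p t)) has_vector_derivative
        \<phi> t (K (p t)) + ad (\<phi> t) (p t)) (at t)" for t
      by (rule blinfun.has_vector_derivative[OF \<phi>(3) p(2)])
    then have "((\<lambda>t. \<phi> t (p t)) has_vector_derivative K (\<phi> t (p t))) (at t)" for t
      by (simp add: ad blinfun.diff_left)
    from bounded_bilinear.has_vector_derivative[OF bounded_bilinear_inner this q(2)]
    have "((\<lambda>t. inner (\<phi> t (p t)) (q t)) has_vector_derivative 0) (at t)" for t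
      by (simp add: skew)
    then obtain c where c: "\<And>t. inner (\<phi> t (p t)) (q t) = c"
      using has_vector_derivative_zero_constant[of UNIV "\<lambda>t. inner (\<phi> t (p t)) (q t)"]
      by auto
    have "norm y * norm y = inner (\<phi> 0 (p 0)) (q 0)"
      unfolding c c[of 1, symmetric] p q y_def
      by (simp add: dot_square_norm power2_eq_square)
    also have "\<dots> \<le> norm (X (p 0)) * norm (q 0)"
      unfolding \<phi> by (rule norm_cauchy_schwarz)
    also have "\<dots> \<le> norm X * norm (p 0) * norm (q 0)"
      by (intro mult_right_mono norm_blinfun) auto
    also have "\<dots> = (norm X * norm x) * norm y"
      using norm_skew_flow[OF skew p(2), of 0 1] norm_skew_flow[OF skew q(2), of 0 1]
      by (simp add: p q)
    finally show ?thesis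
      unfolding y_def[symmetric] by (cases "norm y = 0") auto
  qed
  then have "norm (\<phi> 1) \<le> norm X" by (intro norm_blinfun_bound) auto
  then show ?thesis using \<phi>(2)[of 1] by (intro that) (auto simp: ad)
qed

text \<open>In the proof \<open>C n\<close> is the \<open>n\<close>-fold commutator of the adjoint of \<open>A\<close> with \<open>B\<close>; the claim is
  \<open>C 1 = 0\<close>, and it suffices to see this in every matrix coefficient.\<close>

theorem fuglede:
  fixes A B :: "'a::complex_hilbert_space \<Rightarrow> 'a"
  assumes A: "bounded_clinear A" and B: "bounded_clinear B"
    and comm: "A \<circ> B = B \<circ> A" and normal: "normal_operator A"
  shows "cadjoint A \<circ> B = B \<circ> cadjoint A"
proof
  fix x
  let ?A' = "cadjoint A"
  have A': "bounded_clinear ?A'" by (rule bounded_clinear_cadjoint[OF A])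
  have AA': "A (?A' x) = ?A' (A x)" for x
    using normal by (simp add: normal_operator_def fun_eq_iff)
  define C where "C n = ((\<lambda>T x. ?A' (T x) - T (?A' x)) ^^ n) B" for n
  have C0: "C 0 = B" and CSuc: "C (Suc n) = (\<lambda>x. ?A' (C n x) - C n (?A' x))" for n
    by (simp_all add: C_def)
  have C: "bounded_clinear (C n)" for n
    by (induction n) (simp_all add: C0 CSuc B bounded_clinear_commutator[OF A'])
  have AC: "A (C n x) = C n (A x)" for n x
  proof (induction n arbitrary: x)
    case 0
    then show ?case using comm by (simp add: C0 fun_eq_iff)
  next
    case (Suc n)
    then show ?case by (simp add: CSuc bounded_clinear_diff[OF A] AA')
  qed
  have "cinner (C 1 x) y = 0" for y
  proof -
    define c where "c n = cinner (C n x) y / fact n" for n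
    have bound: "\<exists>w. cmod w \<le> norm (Blinfun B) * norm x * norm y \<and> (\<lambda>n. c n * z ^ n) sums w" for z
    proof -
      \<comment> \<open>the second term makes \<open>K\<close> skew, and as \<open>A\<close> commutes with every \<open>C n\<close> it does not affect the
        commutators\<close>
      define K where "K = Blinfun (\<lambda>x. z *\<^sub>C ?A' x - cnj z *\<^sub>C A x)"
      have K: "K v = z *\<^sub>C ?A' v - cnj z *\<^sub>C A v" for v
        unfolding K_def
        by (subst bounded_linear_Blinfun_apply)
           (intro bounded_linear_sub bounded_linear_compose[OF bounded_linear_scaleC]
              bounded_clinear_imp_bounded_linear[OF A] bounded_clinear_imp_bounded_linear[OF A'] refl)+
      have "cinner (K v) w = - cinner v (K w)" for v w
        by (simp add: K cinner_diff_left cinner_diff_right cinner_scaleC_left cinner_scaleC_right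
            cinner_cadjoint[OF A] cinner_cadjoint_left[OF A])
      then have skew: "inner (K v) w = - inner v (K w)" for v w
        by (metis Re_cinner uminus_complex.sel(1))
      let ?ad = "\<lambda>Z. (K o\<^sub>L Z) - (Z o\<^sub>L K)"
      have adn: "(?ad ^^ n) (Blinfun B) v = z ^ n *\<^sub>C C n v" for n v
      proof (induction n arbitrary: v)
        case 0
        then show ?case
          by (simp add: C0 scaleC_one bounded_linear_Blinfun_apply
              bounded_clinear_imp_bounded_linear[OF B])
      next
        case (Suc n)
        have "(?ad ^^ Suc n) (Blinfun B) v = K (z ^ n *\<^sub>C C n v) - z ^ n *\<^sub>C C n (K v)"
          by (simp add: blinfun.diff_left Suc)
        also have "\<dots> = z ^ Suc n *\<^sub>C C (Suc n) v"
          by (simp add: K CSuc bounded_clinear_scaleC[OF A] bounded_clinear_scaleC[OF A']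
              bounded_clinear_scaleC[OF C] bounded_clinear_diff[OF C] AC
              scaleC_diff_right scaleC_scaleC mult_ac)
        finally show ?case .
      qed
      obtain Y where Y: "norm Y \<le> norm (Blinfun B)"
        "(\<lambda>n. (1 / fact n) *\<^sub>R ((?ad ^^ n) (Blinfun B))) sums Y"
        using commutator_exponential_contraction[OF skew] by blast
      have "bounded_linear (\<lambda>Z::'a \<Rightarrow>\<^sub>L 'a. cinner (Z x) y)"
        by (rule bounded_linear_compose[OF bounded_linear_cinner_left blinfun.bounded_linear_left])
      from bounded_linear.sums[OF this Y(2)]
      have "(\<lambda>n. c n * z ^ n) sums cinner (Y x) y"
        by (simp add: blinfun.scaleR_left adn scaleR_scaleC scaleC_scaleC cinner_scaleC_left
            c_def mult_ac)
      moreover have "cmod (cinner (Y x) y) \<le> norm (Blinfun B) * norm x * norm y"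
        using norm_cinner_le[of "Y x" y] norm_blinfun[of Y x] Y(1)
        by (meson mult_right_mono norm_ge_zero order_trans)
      ultimately show ?thesis by blast
    qed
    define F where "F z = (\<Sum>n. c n * z ^ n)" for z
    have DF: "(F has_field_derivative (\<Sum>n. diffs c n * z ^ n)) (at z)" for z
      unfolding F_def
      by (rule termdiffs_strong_converges_everywhere) (use bound sums_summable in blast)
    then have "F holomorphic_on UNIV"
      by (auto simp: holomorphic_on_open)
    moreover have "bounded (range F)"
    proof (rule boundedI)
      fix w assume "w \<in> range F"
      then obtain z where "w = F z" by blast
      then show "norm w \<le> norm (Blinfun B) * norm x * norm y"
        using bound[of z] sums_unique unfolding F_def by blast
    qed
    ultimately obtain d where "F = (\<lambda>_. d)"
      using Liouville_theorem[of F] by (auto simp: constant_on_def)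
    with DF[of 0] have "(\<Sum>n. diffs c n * 0 ^ n) = 0"
      using DERIV_unique[OF _ DERIV_const] by blast
    then show ?thesis by (simp add: powser_zero diffs_def c_def)
  qed
  then have "C 1 x = 0" by (metis cinner_left_ext cinner_diff_left diff_self)
  then show "(?A' \<circ> B) x = (B \<circ> ?A') x" by (simp add: CSuc C0)
qed

section \<open>Positive square roots\<close>

text \<open>The equation says \<open>(1 - Y)\<^sup>2 = 1 - S\<close>. Convergence is by domination: the scalar iteration
  \<open>r \<mapsto> (1 + r\<^sup>2)/2\<close> started at \<open>0\<close> increases and is bounded by \<open>1\<close>, and its increments bound the
  norms of the increments of the operator iteration. The last property is an induction principle for
  the limit; symmetry and commutation relations are both transferred from \<open>S\<close> to \<open>Y\<close> through it.\<close>

lemma square_root_iteration: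
  fixes S :: "'a::banach \<Rightarrow>\<^sub>L 'a"
  assumes S: "norm S \<le> 1"
  obtains Y where "norm Y \<le> 1" "2 *\<^sub>R Y = S + (Y o\<^sub>L Y)"
    "\<And>M. closed M \<Longrightarrow> 0 \<in> M \<Longrightarrow> (\<And>Z. Z \<in> M \<Longrightarrow> (1/2) *\<^sub>R (S + (Z o\<^sub>L Z)) \<in> M) \<Longrightarrow> Y \<in> M"
proof -
  define Y where "Y n = ((\<lambda>Z. (1/2) *\<^sub>R (S + (Z o\<^sub>L Z))) ^^ n) 0" for n
  define y where "y n = ((\<lambda>r. (1 + r\<^sup>2) / 2) ^^ n) (0::real)" for n
  have Y: "Y 0 = 0" "\<And>n. Y (Suc n) = (1/2) *\<^sub>R (S + (Y n o\<^sub>L Y n))" by (simp_all add: Y_def)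
  have y: "y 0 = 0" "\<And>n. y (Suc n) = (1 + (y n)\<^sup>2) / 2" by (simp_all add: y_def)
  have y01: "0 \<le> y n \<and> y n \<le> 1" for n
    by (induction n) (auto simp: y abs_square_le_1[symmetric] power_le_one)
  have inc: "y n \<le> y (Suc n)" for n
    using zero_le_power2[of "1 - y n"] by (simp add: y power2_diff)
  have nY: "norm (Y n) \<le> y n" for n
  proof (induction n)
    case (Suc n)
    have "norm (Y n o\<^sub>L Y n) \<le> norm (Y n) * norm (Y n)" by (rule norm_blinfun_compose)
    also have "\<dots> \<le> (y n)\<^sup>2"
      unfolding power2_eq_square using Suc y01[of n] by (intro mult_mono) auto
    finally have "norm (S + (Y n o\<^sub>L Y n)) \<le> 1 + (y n)\<^sup>2"
      using S norm_triangle_ineq[of S "(Y n o\<^sub>L Y n)"] by linarith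
    then show ?case by (simp add: Y y)
  qed (simp add: Y y)
  have step: "norm (Y (Suc n) - Y n) \<le> y (Suc n) - y n" for n
  proof (induction n)
    case 0
    then show ?case using S by (simp add: Y y)
  next
    case (Suc n)
    let ?D = "Y (Suc n) - Y n"
    \<comment> \<open>\<open>P\<^sup>2 - Q\<^sup>2 = P(P - Q) + (P - Q)Q\<close>, valid without commutativity\<close>
    have "Y (Suc (Suc n)) - Y (Suc n)
        = (1/2) *\<^sub>R (S + (Y (Suc n) o\<^sub>L Y (Suc n))) - (1/2) *\<^sub>R (S + (Y n o\<^sub>L Y n))"
      using Y(2)[of "Suc n"] Y(2)[of n] by (rule arg_cong2[where f = minus])
    also have "\<dots> = (1/2) *\<^sub>R ((Y (Suc n) o\<^sub>L ?D) + (?D o\<^sub>L Y n))"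
      by (rule blinfun_eqI)
         (simp add: blinfun.bilinear_simps algebra_simps)
    finally have "Y (Suc (Suc n)) - Y (Suc n)
        = (1/2) *\<^sub>R ((Y (Suc n) o\<^sub>L ?D) + (?D o\<^sub>L Y n))" .
    moreover have "norm (Y (Suc n) o\<^sub>L ?D) \<le> y (Suc n) * (y (Suc n) - y n)"
      using norm_blinfun_compose[of "Y (Suc n)" ?D] nY Suc y01
      by (meson mult_mono norm_ge_zero order_trans)
    moreover have "norm (?D o\<^sub>L Y n) \<le> (y (Suc n) - y n) * y n"
      using norm_blinfun_compose[of ?D "Y n"] nY Suc y01
      by (meson mult_mono norm_ge_zero order_trans)
    moreover have "y (Suc (Suc n)) - y (Suc n)
        = (y (Suc n) * (y (Suc n) - y n) + (y (Suc n) - y n) * y n) / 2"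
      unfolding y(2)[of "Suc n"] by (subst (2) y(2)) (simp add: power2_eq_square field_simps)
    ultimately show ?case
      using norm_triangle_ineq[of "(Y (Suc n) o\<^sub>L ?D)" "(?D o\<^sub>L Y n)"] by simp
  qed
  obtain l where "y \<longlonglongrightarrow> l"
    using incseq_convergent[of y 1] y01 inc unfolding incseq_Suc_iff by blast
  then have "summable (\<lambda>n. y (Suc n) - y n)" by (rule telescope_summable)
  then have "summable (\<lambda>n. Y (Suc n) - Y n)"
    by (rule summable_comparison_test'[where N = 0]) (rule step)
  from summable_LIMSEQ[OF this] obtain Z where Z: "Y \<longlonglongrightarrow> Z"
    unfolding sum_lessThan_telescope Y(1) by auto
  have "norm Z \<le> 1"
    using tendsto_norm[OF Z] by (rule LIMSEQ_le_const2) (use nY y01 order_trans in blast)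
  moreover have "2 *\<^sub>R Z = S + (Z o\<^sub>L Z)"
  proof -
    have "(\<lambda>n. 2 *\<^sub>R Y (Suc n)) \<longlonglongrightarrow> 2 *\<^sub>R Z"
      by (intro tendsto_intros LIMSEQ_Suc Z)
    moreover have "(\<lambda>n. S + (Y n o\<^sub>L Y n)) \<longlonglongrightarrow> S + (Z o\<^sub>L Z)"
      by (intro tendsto_intros bounded_bilinear.tendsto[OF bounded_bilinear_blinfun_compose] Z)
    moreover have "(\<lambda>n. 2 *\<^sub>R Y (Suc n)) = (\<lambda>n. S + (Y n o\<^sub>L Y n))"
      by (simp add: Y(2))
    ultimately show ?thesis by (metis LIMSEQ_unique)
  qed
  moreover have "Z \<in> M" if "closed M" "0 \<in> M"
    and M: "\<And>Z. Z \<in> M \<Longrightarrow> (1/2) *\<^sub>R (S + (Z o\<^sub>L Z)) \<in> M" for M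
  proof -
    have "Y n \<in> M" for n by (induction n) (auto simp: Y(1) that(2) Y(2) intro: M)
    then show ?thesis using closed_sequentially[OF that(1) _ Z] by blast
  qed
  ultimately show ?thesis by (rule that)
qed

lemma positive_operator_Re_nonneg: "positive_operator P \<Longrightarrow> 0 \<le> inner (P x) x"
  by (simp add: positive_operator_def Re_cinner)

text \<open>Polarisation: realness of the quadratic form at \<open>u + v\<close> controls the imaginary part of
  \<open>cinner (P u) v + cinner (P v) u\<close>, and \<open>u = \<i>x\<close> turns it into a real part.\<close>

lemma positive_operator_symmetric:
  assumes P: "positive_operator P"
  shows "inner (P x) y = inner x (P y)"
proof -
  have cl: "bounded_clinear P" and re: "\<And>x. Im (cinner (P x) x) = 0"
    using P by (auto simp: positive_operator_def complex_is_Real_iff)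
  have "Im (cinner (P u) v + cinner (P v) u) = 0" for u v
    using re[of "u + v"] re[of u] re[of v]
    by (simp add: bounded_clinear_add[OF cl] cinner_add_left cinner_add_right)
  from this[of "\<i> *\<^sub>C x" y] have "Re (cinner (P x) y) = Re (cinner (P y) x)"
    by (simp add: bounded_clinear_scaleC[OF cl] cinner_scaleC_left cinner_scaleC_right)
  then show ?thesis by (simp add: Re_cinner inner_commute)
qed

text \<open>If \<open>P y\<close> were nonzero, moving from \<open>y\<close> in the direction \<open>- P y\<close> would make the quadratic form
  negative to first order.\<close>

lemma positive_operator_kernel:
  assumes P: "positive_operator P" and 0: "inner (P y) y = 0"
  shows "P y = 0"
proof (rule ccontr)
  assume ne: "P y \<noteq> 0"
  have lin: "linear P" using P by (simp add: positive_operator_def bounded_clinear_def bounded_linear.linear)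
  define a where "a = inner (P y) (P y)"
  define b where "b = inner (P (P y)) (P y)"
  have ab: "a > 0" "b \<ge> 0" using ne positive_operator_Re_nonneg[OF P] by (auto simp: a_def b_def)
  define t where "t = - a / (b + 1)"
  have "0 \<le> inner (P (y + t *\<^sub>R P y)) (y + t *\<^sub>R P y)" by (rule positive_operator_Re_nonneg[OF P])
  also have "\<dots> = 2 * t * a + t\<^sup>2 * b"
    using 0 positive_operator_symmetric[OF P, of "P y" y]
    by (simp add: linear_add[OF lin] linear_scale[OF lin] inner_add_left inner_add_right
        a_def b_def power2_eq_square algebra_simps)
  also have "\<dots> = - (t\<^sup>2 * (b + 2))"
  proof -
    have "a = - t * (b + 1)" using ab by (simp add: t_def)
    then show ?thesis by algebra
  qed
  also have "\<dots> < 0" using ab by (simp add: t_def)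
  finally show False by simp
qed

text \<open>Since \<open>(P + Q)(P - Q) = 0\<close>, the form of \<open>P + Q\<close> vanishes on the range of \<open>P - Q\<close>; by positivity
  that range lies in both kernels, and it is orthogonal to them by symmetry.\<close>

lemma positive_square_root_unique:
  assumes P: "positive_operator P" and Q: "positive_operator Q"
    and sq: "P \<circ> P = Q \<circ> Q" and comm: "P \<circ> Q = Q \<circ> P"
  shows "P = Q"
proof
  fix x
  have lin: "linear P" "linear Q"
    using P Q by (auto simp: positive_operator_def bounded_clinear_def bounded_linear.linear)
  define y where "y = P x - Q x"
  have "P y + Q y = 0"
    using sq comm by (simp add: y_def linear_diff lin fun_eq_iff)
  then have "inner (P y) y + inner (Q y) y = 0" by (simp flip: inner_add_left)
  then have "inner (P y) y = 0" "inner (Q y) y = 0"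
    using positive_operator_Re_nonneg[OF P, of y] positive_operator_Re_nonneg[OF Q, of y] by linarith+
  then have "P y = 0" "Q y = 0"
    by (auto intro: positive_operator_kernel P Q)
  then have "inner y y = 0"
    unfolding y_def inner_diff_left positive_operator_symmetric[OF P] positive_operator_symmetric[OF Q]
    by simp
  then show "P x = Q x" by (simp add: y_def)
qed

text \<open>With \<open>c\<close> a bound for \<open>T\<close> and \<open>G\<close> the product of the adjoint and \<open>T\<close>, the operator
  \<open>S = 1 - G/c\<^sup>2\<close> is a contraction, and the root is \<open>c(1 - Y)\<close>. Complex linearity of the root is an
  instance of the commutation property, since \<open>G\<close> commutes with complex scalars. The commutation
  property is part of the conclusion because uniqueness of the root depends on it.\<close>

lemma positive_square_root_exists:
  fixes T :: "'a::complex_hilbert_space \<Rightarrow> 'a"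
  assumes T: "bounded_clinear T"
  obtains Q where "positive_operator Q" "Q \<circ> Q = cadjoint T \<circ> T"
    "\<And>X. bounded_linear X \<Longrightarrow> X \<circ> (cadjoint T \<circ> T) = (cadjoint T \<circ> T) \<circ> X \<Longrightarrow> X \<circ> Q = Q \<circ> X"
proof -
  have T': "bounded_clinear (cadjoint T)" by (rule bounded_clinear_cadjoint[OF T])
  obtain c where c: "c > 0" "\<And>x. norm (T x) \<le> c * norm x"
    using bounded_linear.pos_bounded[OF bounded_clinear_imp_bounded_linear[OF T]]
    by (auto simp: mult.commute)
  define G where "G x = cadjoint T (T x)" for x
  have innerG: "inner (G x) y = inner (T x) (T y)" for x y
    unfolding G_def by (metis Re_cinner cinner_cadjoint_left[OF T])
  have blG: "bounded_linear G"
    unfolding G_def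
    by (rule bounded_linear_compose[OF T'[THEN bounded_clinear_imp_bounded_linear]
          T[THEN bounded_clinear_imp_bounded_linear]])
  define S where "S = Blinfun (\<lambda>x. x - (1 / c\<^sup>2) *\<^sub>R G x)"
  have S: "S x = x - (1 / c\<^sup>2) *\<^sub>R G x" for x
    unfolding S_def
    by (subst bounded_linear_Blinfun_apply)
       (intro bounded_linear_sub bounded_linear_ident bounded_linear_compose[OF bounded_linear_scaleR_right]
          blG refl)+
  have "norm (S x) \<le> 1 * norm x" for x
  proof -
    have "norm (G x) \<le> c * norm (T x)"
      unfolding G_def by (rule norm_cadjoint_le[OF T c(2)])
    then have "(norm (G x))\<^sup>2 \<le> c\<^sup>2 * (norm (T x))\<^sup>2"
      by (metis norm_ge_zero power_mono power_mult_distrib)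
    then have "(1 / c\<^sup>2)\<^sup>2 * (norm (G x))\<^sup>2 \<le> (1 / c\<^sup>2)\<^sup>2 * (c\<^sup>2 * (norm (T x))\<^sup>2)"
      by (intro mult_left_mono) auto
    also have "\<dots> = (1 / c\<^sup>2) * (norm (T x))\<^sup>2"
      using c(1) by (simp add: power2_eq_square)
    finally have *: "(1 / c\<^sup>2)\<^sup>2 * (norm (G x))\<^sup>2 \<le> (1 / c\<^sup>2) * (norm (T x))\<^sup>2" .
    have "(norm (S x))\<^sup>2 = (norm x)\<^sup>2 - 2 * ((1 / c\<^sup>2) * (norm (T x))\<^sup>2) + (1 / c\<^sup>2)\<^sup>2 * (norm (G x))\<^sup>2"
      unfolding S power2_norm_eq_inner
      by (simp add: inner_diff_left inner_diff_right innerG inner_commute[of x "G x"]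
          power2_eq_square diff_divide_distrib)
    moreover have "0 \<le> (1 / c\<^sup>2) * (norm (T x))\<^sup>2" by simp
    ultimately have "(norm (S x))\<^sup>2 \<le> (norm x)\<^sup>2" using * by linarith
    then show ?thesis by (simp add: power2_le_iff_abs_le)
  qed
  then have "norm S \<le> 1" by (intro norm_blinfun_bound) auto
  then obtain Y where Y: "norm Y \<le> 1" "2 *\<^sub>R Y = S + (Y o\<^sub>L Y)"
    and ind: "\<And>M. closed M \<Longrightarrow> 0 \<in> M \<Longrightarrow> (\<And>Z. Z \<in> M \<Longrightarrow> (1/2) *\<^sub>R (S + (Z o\<^sub>L Z)) \<in> M) \<Longrightarrow> Y \<in> M"
    by (rule square_root_iteration) blast
  define Q where "Q x = c *\<^sub>R (x - Y x)" for x
  have YY: "Y (Y x) = 2 *\<^sub>R Y x - S x" for x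
    using Y(2) by (metis add_diff_cancel_left' blinfun.add_left blinfun.scaleR_left blinfun_apply_blinfun_compose)
  have QQ: "Q (Q x) = G x" for x
  proof -
    have "Q (Q x) = (c * c) *\<^sub>R (x - Y x - (Y x - Y (Y x)))"
      by (simp add: Q_def blinfun.scaleR_right blinfun.diff_right scaleR_diff_right)
    also have "x - Y x - (Y x - Y (Y x)) = (1 / c\<^sup>2) *\<^sub>R G x"
      unfolding YY S by (simp add: scaleR_2)
    finally show ?thesis using c(1) by (simp add: power2_eq_square)
  qed
  have commute: "X \<circ> Q = Q \<circ> X" if X: "bounded_linear X" and XG: "X \<circ> G = G \<circ> X" for X
  proof -
    interpret X: bounded_linear X by fact
    have "Y \<in> {Z::'a \<Rightarrow>\<^sub>L 'a. \<forall>x. X (Z x) = Z (X x)}"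
    proof (rule ind)
      show "closed {Z::'a \<Rightarrow>\<^sub>L 'a. \<forall>x. X (Z x) = Z (X x)}"
        by (intro closed_Collect_all closed_Collect_eq X.continuous_on continuous_intros)
      fix Z :: "'a \<Rightarrow>\<^sub>L 'a"
      assume "Z \<in> {Z::'a \<Rightarrow>\<^sub>L 'a. \<forall>x. X (Z x) = Z (X x)}"
      moreover have "X (G x) = G (X x)" for x using XG by (simp add: fun_eq_iff)
      ultimately show "(1/2) *\<^sub>R (S + (Z o\<^sub>L Z)) \<in> {Z::'a \<Rightarrow>\<^sub>L 'a. \<forall>x. X (Z x) = Z (X x)}"
        by (simp add: blinfun.add_left blinfun.scaleR_left S X.scaleR X.add X.diff)
    qed (simp add: X.zero)
    then show ?thesis by (auto simp: Q_def X.scaleR X.diff)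
  qed
  have sym: "inner (Q x) y = inner x (Q y)" for x y
  proof -
    have "Y \<in> {Z::'a \<Rightarrow>\<^sub>L 'a. \<forall>x y. inner (Z x) y = inner x (Z y)}"
    proof (rule ind)
      show "closed {Z::'a \<Rightarrow>\<^sub>L 'a. \<forall>x y. inner (Z x) y = inner x (Z y)}"
        by (intro closed_Collect_all closed_Collect_eq continuous_intros)
      fix Z :: "'a \<Rightarrow>\<^sub>L 'a"
      assume "Z \<in> {Z::'a \<Rightarrow>\<^sub>L 'a. \<forall>x y. inner (Z x) y = inner x (Z y)}"
      moreover have "inner (S x) y = inner x (S y)" for x y
      proof -
        have "inner (G x) y = inner x (G y)" by (metis innerG inner_commute)
        then show ?thesis by (simp add: S inner_diff_left inner_diff_right)
      qed
      ultimately show "(1/2) *\<^sub>R (S + (Z o\<^sub>L Z)) \<in> {Z::'a \<Rightarrow>\<^sub>L 'a. \<forall>x y. inner (Z x) y = inner x (Z y)}"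
        by (simp add: blinfun.add_left blinfun.scaleR_left inner_add_left inner_add_right)
    qed simp
    then show ?thesis by (simp add: Q_def inner_diff_left inner_diff_right)
  qed
  have scQ: "Q (a *\<^sub>C x) = a *\<^sub>C Q x" for a x
  proof -
    have "(*\<^sub>C) a \<circ> G = G \<circ> (*\<^sub>C) a"
      by (auto simp: G_def bounded_clinear_scaleC[OF T] bounded_clinear_scaleC[OF T'])
    from commute[OF bounded_linear_scaleC this] show ?thesis by (simp add: fun_eq_iff)
  qed
  have "positive_operator Q"
    unfolding positive_operator_def bounded_clinear_def
  proof (intro conjI allI scQ)
    show "bounded_linear Q"
      unfolding Q_def
      by (intro bounded_linear_compose[OF bounded_linear_scaleR_right] bounded_linear_sub
          bounded_linear_ident blinfun.bounded_linear_right)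
    fix x
    have "inner (\<i> *\<^sub>C Q x) x = inner (\<i> *\<^sub>C x) (Q x)"
      by (metis scQ sym)
    then have "cinner (Q x) x = cinner x (Q x)"
      by (simp add: cinner_eq_Complex inner_commute)
    then show "cinner (Q x) x \<in> \<real>"
      by (metis Reals_cnj_iff cinner_commute)
    have "inner (Y x) x \<le> norm (Y x) * norm x" by (rule norm_cauchy_schwarz)
    also have "\<dots> \<le> 1 * norm x * norm x"
      using norm_blinfun[of Y x] Y(1)
      by (intro mult_right_mono order_trans[OF norm_blinfun]) auto
    finally have "inner (Y x) x \<le> inner x x" by (simp add: dot_square_norm power2_eq_square)
    then show "0 \<le> Re (cinner (Q x) x)"
      using c(1) by (simp add: Re_cinner Q_def inner_diff_left)
  qed
  moreover have "Q \<circ> Q = cadjoint T \<circ> T" "G = cadjoint T \<circ> T"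
    using QQ by (auto simp: G_def)
  ultimately show ?thesis using commute by (intro that[of Q]) auto
qed

text \<open>Any competing root \<open>P\<close> commutes with its own square, hence with the root constructed above, so
  uniqueness for commuting roots applies and the description defining \<open>modulus\<close> is proper.\<close>

lemma modulus_works:
  fixes T :: "'a::complex_hilbert_space \<Rightarrow> 'a"
  assumes T: "bounded_clinear T"
  shows positive_modulus: "positive_operator (modulus T)"
    and modulus_square: "modulus T \<circ> modulus T = cadjoint T \<circ> T"
    and modulus_commute: "bounded_linear X \<Longrightarrow> X \<circ> (cadjoint T \<circ> T) = (cadjoint T \<circ> T) \<circ> X
      \<Longrightarrow> X \<circ> modulus T = modulus T \<circ> X"
proof -
  obtain Q where Q: "positive_operator Q" "Q \<circ> Q = cadjoint T \<circ> T"
    "\<And>X. bounded_linear X \<Longrightarrow> X \<circ> (cadjoint T \<circ> T) = (cadjoint T \<circ> T) \<circ> X \<Longrightarrow> X \<circ> Q = Q \<circ> X"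
    using positive_square_root_exists[OF T] by blast
  have "P = Q" if P: "positive_operator P \<and> P \<circ> P = cadjoint T \<circ> T" for P
  proof (rule positive_square_root_unique)
    have "bounded_linear P" using P by (simp add: positive_operator_def bounded_clinear_def)
    moreover have "P \<circ> (cadjoint T \<circ> T) = (cadjoint T \<circ> T) \<circ> P"
      using P by (metis comp_assoc)
    ultimately show "P \<circ> Q = Q \<circ> P" by (rule Q(3))
  qed (use P Q(1,2) in auto)
  then have "modulus T = Q"
    unfolding modulus_def using Q(1,2) by (intro the_equality conjI)
  with Q show "positive_operator (modulus T)" "modulus T \<circ> modulus T = cadjoint T \<circ> T"
    "bounded_linear X \<Longrightarrow> X \<circ> (cadjoint T \<circ> T) = (cadjoint T \<circ> T) \<circ> X
      \<Longrightarrow> X \<circ> modulus T = modulus T \<circ> X"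
    by blast+
qed

section \<open>Commuting moduli\<close>

theorem proposition2p1:
  fixes A B :: "'a::complex_hilbert_space \<Rightarrow> 'a"
  assumes "bounded_clinear A" and "bounded_clinear B"
    and "A \<circ> B = B \<circ> A"
    and "normal_operator A"
  shows "modulus A \<circ> modulus B = modulus B \<circ> modulus A"
proof -
  note A = assms(1) and B = assms(2)
  let ?A = "cadjoint A" and ?B = "cadjoint B"
  have AB: "A (B x) = B (A x)" for x using assms(3) by (simp add: fun_eq_iff)
  have A'B: "?A (B x) = B (?A x)" for x using fuglede[OF assms] by (simp add: fun_eq_iff)
  have A'B': "?A (?B x) = ?B (?A x)" for x
    by (rule cinner_right_ext) (simp add: AB flip: cinner_cadjoint[OF A] cinner_cadjoint[OF B])
  have AB': "A (?B x) = ?B (A x)" for x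
    by (rule cinner_right_ext)
       (simp add: A'B flip: cinner_cadjoint_left[OF A] cinner_cadjoint[OF B])
  have "(?B \<circ> B) \<circ> (?A \<circ> A) = (?A \<circ> A) \<circ> (?B \<circ> B)"
    by (simp add: fun_eq_iff AB A'B AB' A'B')
  moreover have "bounded_linear (?B \<circ> B)"
    unfolding comp_def
    by (intro bounded_linear_compose[OF bounded_clinear_imp_bounded_linear[OF bounded_clinear_cadjoint[OF B]]]
        bounded_clinear_imp_bounded_linear[OF B])
  ultimately have "(?B \<circ> B) \<circ> modulus A = modulus A \<circ> (?B \<circ> B)"
    by (intro modulus_commute[OF A])
  moreover have "bounded_linear (modulus A)"
    using positive_modulus[OF A] by (simp add: positive_operator_def bounded_clinear_def)
  ultimately show ?thesis by (intro modulus_commute[OF B]) simp_all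
qed

end
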